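(* There exists a convex Kakeya body $K\subseteq\mathbb{R}^3$ such that there is no continuous function $\psi:\mathbb{S}^2\to\mathbb{R}^3$ satisfying $\psi(v)+tv\in K$ for all $v\in\mathbb{S}^2$ and $t\in[0,1]$.
   Context: $\mathbb{S}^2$ is the unit sphere in $\mathbb{R}^3$. A convex Kakeya body $K\subseteq\mathbb{R}^3$ is a compact convex set such that for every $v\in\mathbb{S}^{2}$ there is some $w\in K$ with $w+tv\in K$ for all $t\in[0,1]$. *)

theory Defs
  imports "HOL-Analysis.Analysis"
begin

definition convex_kakeya_body :: "(real ^ 3) set \<Rightarrow> bool" where
  "convex_kakeya_body K \<longleftrightarrow> compact K \<and> convex K \<and>
     (\<forall>v \<in> sphere 0 1. \<exists>w \<in> K. \<forall>t \<in> {0..1}. w + t *\<^sub>R v \<in> K)"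

end

theory Submission
  imports Defs
begin

text \<open>
  A compact convex set \<open>K\<close> is a Kakeya body as soon as its width in every direction is at least 1:
  otherwise some unit vector could be strictly separated from the convex set \<open>K - K\<close>
  (\<open>convex_kakeya_bodyI_width\<close>).  This leaves much freedom to prescribe where the segments
  lie in those directions in which the width is exactly 1.

  Write points as \<open>(x, y, z)\<close>.  The body is the convex hull of three pieces: the segment
  \<open>\<bar>x\<bar> \<le> 2\<close> on the \<open>x\<close>-axis, a piece of the unit cylinder around that axis, on which
  \<open>y > 0\<close> forces \<open>1 \<le> x \<le> 2\<close> and \<open>y < 0\<close> forces \<open>-2 \<le> x \<le> -1\<close>, and a wide rectangle at height
  \<open>1/2\<close>.  In a direction \<open>(0, t, \<surd>(1 - t\<^sup>2))\<close> with \<open>t \<noteq> 0\<close> small, the width of the body is exactly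
  1, and the upper supporting plane touches the body only at points with
  \<open>(y, z) = (t, \<surd>(1 - t\<^sup>2))\<close>, which belong to the cylinder piece.  Hence a unit segment in this
  direction lies in \<open>x \<ge> 1\<close> if \<open>t > 0\<close> and in \<open>x \<le> -1\<close> if \<open>t < 0\<close>
  (\<open>kakeya_hull_tilted_segment\<close>).  A continuous choice of segments would have to satisfy both
  inequalities at \<open>t = 0\<close>.

  The width is at least 1 in every direction (\<open>kakeya_hull_width\<close>), although only half of the
  cylinder is available over each point of the arc with \<open>y \<noteq> 0\<close>.  Indeed, for a direction \<open>(u\<^sub>1, u\<^sub>2, u\<^sub>3)\<close> with
  \<open>(u\<^sub>2, u\<^sub>3)\<close> of norm \<open>r > 0\<close> and within 30 degrees of the vertical, the width is at least \<open>\<bar>u\<^sub>1\<bar> + r\<close>: the range of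
  \<open>x\<close> on the axis is so long that a point of the axis lies at distance at least 1 in the
  \<open>x\<close>-direction, on whichever side is needed, from a point of the cylinder piece.  For the other
  directions the rectangle is wide enough.
\<close>

section \<open>Kakeya bodies and widths\<close>

text \<open>The third hypothesis says that the width of \<open>K\<close> in every direction is at least 1.\<close>

lemma convex_kakeya_bodyI_width:
  assumes "compact K" "convex K"
    and width: "\<And>u. \<exists>p\<in>K. \<exists>q\<in>K. norm u \<le> u \<bullet> (p - q)"
  shows "convex_kakeya_body K"
proof -
  define D where "D = {p - q | p q. p \<in> K \<and> q \<in> K}"
  have D: "p - q \<in> D" if "p \<in> K" "q \<in> K" for p q
    using that by (auto simp: D_def)
  have "convex D"
  proof -
    have "D = (\<Union>p\<in>K. \<Union>q\<in>K. {p - q})" by (auto simp: D_def)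
    then show ?thesis using convex_differences[OF assms(2) assms(2)] by simp
  qed
  have "compact D"
    using compact_differences[OF assms(1) assms(1)] by (simp add: D_def)
  have "\<exists>w\<in>K. \<forall>t\<in>{0..1}. w + t *\<^sub>R v \<in> K" if v: "v \<in> sphere 0 1" for v
  proof -
    have "v \<in> D"
    proof (rule ccontr)
      assume "v \<notin> D"
      then obtain a b where ab: "a \<bullet> v < b" "\<And>x. x \<in> D \<Longrightarrow> a \<bullet> x > b"
        using separating_hyperplane_closed_point[OF \<open>convex D\<close> compact_imp_closed[OF \<open>compact D\<close>]]
        by blast
      obtain p q where pq: "p \<in> K" "q \<in> K" "norm (- a) \<le> (- a) \<bullet> (p - q)"
        using width by blast
      have "a \<bullet> (p - q) > b" using ab(2) D pq by blast
      moreover have "- (a \<bullet> v) \<le> norm a"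
        using Cauchy_Schwarz_ineq2[of a v] v by simp
      ultimately show False using ab(1) pq(3) by simp
    qed
    then obtain p q where pq: "p \<in> K" "q \<in> K" "v = p - q" by (auto simp: D_def)
    have "q + t *\<^sub>R v \<in> K" if "t \<in> {0..1}" for t
    proof -
      have "(1 - t) *\<^sub>R q + t *\<^sub>R p \<in> K"
        using convexD[OF assms(2) pq(2,1), of "1 - t" t] that by simp
      then show ?thesis by (simp add: pq(3) algebra_simps)
    qed
    then show ?thesis using pq(2) by blast
  qed
  then show ?thesis using assms by (simp add: convex_kakeya_body_def)
qed

text \<open>An open half-space together with a convex part of its bounding hyperplane is convex.\<close>

lemma convex_open_halfspace_Un_face:
  assumes "convex C"
  shows "convex {w. a \<bullet> w < b \<or> (a \<bullet> w = b \<and> w \<in> C)}"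
proof (rule convexI)
  fix p q :: 'a and s t :: real
  assume p: "p \<in> {w. a \<bullet> w < b \<or> (a \<bullet> w = b \<and> w \<in> C)}"
    and q: "q \<in> {w. a \<bullet> w < b \<or> (a \<bullet> w = b \<and> w \<in> C)}"
    and st: "0 \<le> s" "0 \<le> t" "s + t = 1"
  show "s *\<^sub>R p + t *\<^sub>R q \<in> {w. a \<bullet> w < b \<or> (a \<bullet> w = b \<and> w \<in> C)}"
  proof (cases "s = 0 \<or> t = 0")
    case True
    then show ?thesis using p q st by auto
  next
    case False
    then have pos: "s > 0" "t > 0" using st by auto
    have val: "a \<bullet> (s *\<^sub>R p + t *\<^sub>R q) = s * (a \<bullet> p) + t * (a \<bullet> q)"
      by (simp add: inner_add_right)
    have b: "b = s * b + t * b" using st by (metis distrib_right mult_1)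
    show ?thesis
    proof (cases "a \<bullet> p = b \<and> a \<bullet> q = b")
      case True
      then have "s *\<^sub>R p + t *\<^sub>R q \<in> C"
        using p q st convexD[OF assms] by auto
      then show ?thesis using True val b by simp
    next
      case False
      then have "a \<bullet> p \<le> b" "a \<bullet> q \<le> b" "a \<bullet> p < b \<or> a \<bullet> q < b" using p q by auto
      then have "s * (a \<bullet> p) + t * (a \<bullet> q) < s * b + t * b"
        using pos by (meson add_le_less_mono add_less_le_mono less_imp_le
            mult_left_mono mult_strict_left_mono)
      then show ?thesis using val b by simp
    qed
  qed
qed

section \<open>The body and its widths\<close>

text \<open>
  The axis segment, the cylinder piece and the rectangle that span the body.  Over the point
  \<open>(y, z) = (0, 1)\<close> of the unit circle the cylinder piece contains both \<open>1 \<le> x \<le> 2\<close> and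
  \<open>-2 \<le> x \<le> -1\<close>; this is where its two halves meet.
\<close>

definition kakeya_generators :: "(real ^ 3) set" where
  "kakeya_generators =
     {p. \<bar>p $ 1\<bar> \<le> 2 \<and> p $ 2 = 0 \<and> p $ 3 = 0} \<union>
     {p. 1 \<le> \<bar>p $ 1\<bar> \<and> \<bar>p $ 1\<bar> \<le> 2 \<and> 0 \<le> p $ 1 * p $ 2 \<and>
         \<bar>p $ 2\<bar> \<le> 1/2 \<and> 0 \<le> p $ 3 \<and> (p $ 2)\<^sup>2 + (p $ 3)\<^sup>2 = 1} \<union>
     {p. \<bar>p $ 1\<bar> \<le> 2 \<and> \<bar>p $ 2\<bar> \<le> 1 \<and> p $ 3 = 1/2}"

lemma compact_kakeya_generators: "compact kakeya_generators"
proof -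
  have "closed kakeya_generators"
    unfolding kakeya_generators_def
    by (intro closed_Un closed_Collect_conj closed_Collect_le closed_Collect_eq continuous_intros)
  moreover have "norm p \<le> 4" if "p \<in> kakeya_generators" for p
  proof -
    have "\<bar>p $ 3\<bar> \<le> 1"
    proof -
      have "(p $ 2)\<^sup>2 + (p $ 3)\<^sup>2 = 1 \<or> (p $ 3)\<^sup>2 = 0 \<or> (p $ 3)\<^sup>2 = (1/2)\<^sup>2"
        using that by (auto simp: kakeya_generators_def)
      then have "(p $ 3)\<^sup>2 \<le> 1"
        using zero_le_power2[of "p $ 2"]
        by (elim disjE) (linarith, simp_all add: power_one_over)
      then show ?thesis by (simp add: abs_square_le_1)
    qed
    moreover have "\<bar>p $ 1\<bar> \<le> 2" "\<bar>p $ 2\<bar> \<le> 1"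
      using that by (auto simp: kakeya_generators_def)
    ultimately show ?thesis
      using norm_le_l1_cart[of p] by (simp add: sum_3)
  qed
  ultimately show ?thesis
    by (auto simp: compact_eq_bounded_closed intro: boundedI)
qed

text \<open>The convex Kakeya body without a continuous choice of segments.\<close>

definition kakeya_hull :: "(real ^ 3) set" where
  "kakeya_hull = convex hull kakeya_generators"

lemma kakeya_hull_width: "\<exists>p\<in>kakeya_hull. \<exists>q\<in>kakeya_hull. norm u \<le> u \<bullet> (p - q)"
proof -
  \<comment> \<open>The width is an even function of the direction, so one may assume that the third
    coordinate is nonnegative.\<close>
  have upper: "\<exists>p\<in>kakeya_generators. \<exists>q\<in>kakeya_generators. norm u \<le> u \<bullet> (p - q)"
    if u3: "u $ 3 \<ge> 0" for u :: "real ^ 3"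
  proof -
    define r where "r = sqrt ((u $ 2)\<^sup>2 + (u $ 3)\<^sup>2)"
    have r: "r \<ge> 0" "r\<^sup>2 = (u $ 2)\<^sup>2 + (u $ 3)\<^sup>2" by (auto simp: r_def)
    have "(norm u)\<^sup>2 = (u $ 1)\<^sup>2 + r\<^sup>2"
      unfolding r power2_norm_eq_inner by (simp add: inner_vec_def sum_3 power2_eq_square)
    also have "\<dots> \<le> (\<bar>u $ 1\<bar> + r)\<^sup>2" using r(1) by (simp add: power2_sum)
    finally have norm_u: "norm u \<le> \<bar>u $ 1\<bar> + r"
      by (rule power2_le_imp_le) (use r(1) in simp)
    show ?thesis
    proof (cases "2 * \<bar>u $ 2\<bar> \<le> r \<and> r > 0")
      case True
      define s :: real where "s = (if u $ 2 < 0 then -1 else 1)"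
      \<comment> \<open>The end of the admissible \<open>x\<close>-range on the cylinder that is favoured by the sign of \<open>u $ 1\<close>,
        and the opposite end of the axis segment; thus \<open>x - x' \<ge> 1\<close> if \<open>u $ 1 \<ge> 0\<close>, and
        \<open>x - x' \<le> -1\<close> otherwise.\<close>
      define x where "x = (if s * u $ 1 \<ge> 0 then 2 * s else s)"
      define x' where "x' = (if u $ 1 \<ge> 0 then -2 else 2 :: real)"
      define p :: "real ^ 3" where "p = vector [x, u $ 2 / r, u $ 3 / r]"
      define q :: "real ^ 3" where "q = vector [x', 0, 0]"
      have "(u $ 2 / r)\<^sup>2 + (u $ 3 / r)\<^sup>2 = 1"
        using True by (simp add: power_divide flip: add_divide_distrib r(2))
      moreover have "0 \<le> x * (u $ 2 / r)"
      proof -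
        have "0 \<le> x * u $ 2" by (simp add: x_def s_def)
        then show ?thesis using r(1) by simp
      qed
      moreover have "\<bar>u $ 2 / r\<bar> \<le> 1/2"
        using True by (simp add: abs_divide pos_divide_le_eq)
      moreover have "1 \<le> \<bar>x\<bar>" "\<bar>x\<bar> \<le> 2" by (simp_all add: x_def s_def)
      ultimately have "p \<in> kakeya_generators"
        using True u3 by (simp add: kakeya_generators_def p_def)
      moreover have "q \<in> kakeya_generators"
        by (auto simp: kakeya_generators_def q_def x'_def)
      moreover have "u \<bullet> (p - q) = u $ 1 * (x - x') + r"
      proof -
        have "u $ 2 * (u $ 2 / r) + u $ 3 * (u $ 3 / r) = r\<^sup>2 / r"
          unfolding r(2) by (simp add: power2_eq_square add_divide_distrib)
        then show ?thesis
          using True by (simp add: p_def q_def inner_vec_def sum_3 power2_eq_square)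
      qed
      moreover have "u $ 1 * (x - x') \<ge> \<bar>u $ 1\<bar>"
        by (auto simp: x_def x'_def s_def)
      ultimately show ?thesis using norm_u by (smt (verit))
    next
      \<comment> \<open>Opposite corners of the rectangle give enough width here.\<close>
      case False
      define x where "x = (if u $ 1 \<ge> 0 then 2 else -2 :: real)"
      define y where "y = (if u $ 2 \<ge> 0 then 1 else -1 :: real)"
      define p :: "real ^ 3" where "p = vector [x, y, 1/2]"
      define q :: "real ^ 3" where "q = vector [-x, -y, 1/2]"
      have "p \<in> kakeya_generators" "q \<in> kakeya_generators"
        by (auto simp: kakeya_generators_def p_def q_def x_def y_def)
      moreover have "u \<bullet> (p - q) = 4 * \<bar>u $ 1\<bar> + 2 * \<bar>u $ 2\<bar>"
        by (simp add: p_def q_def inner_vec_def sum_3 x_def y_def)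
      moreover have "r \<le> 2 * \<bar>u $ 2\<bar>" using False r(1) by linarith
      ultimately show ?thesis using norm_u by (smt (verit))
    qed
  qed
  have sub: "kakeya_generators \<subseteq> kakeya_hull"
    unfolding kakeya_hull_def by (rule hull_subset)
  show ?thesis
  proof (cases "u $ 3 \<ge> 0")
    case True
    then show ?thesis using upper sub by blast
  next
    case False
    then obtain p q where "p \<in> kakeya_generators" "q \<in> kakeya_generators"
      "norm u \<le> (- u) \<bullet> (p - q)"
      using upper[of "- u"] by auto
    moreover have "(- u) \<bullet> (p - q) = u \<bullet> (q - p)" by (simp add: inner_diff_right)
    ultimately show ?thesis using sub by (metis subsetD)
  qed
qed

section \<open>Unit segments in nearly vertical directions\<close>

text \<open>For \<open>\<bar>t\<bar> \<le> 1\<close>, the unit vector above \<open>(0, t)\<close>; it passes through the vertical at \<open>t = 0\<close>.\<close>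

definition tilt :: "real \<Rightarrow> real ^ 3" where
  "tilt t = vector [0, t, sqrt (1 - t\<^sup>2)]"

lemma tilt_nth [simp]: "tilt t $ 1 = 0" "tilt t $ 2 = t" "tilt t $ 3 = sqrt (1 - t\<^sup>2)"
  by (simp_all add: tilt_def)

lemma inner_tilt: "tilt t \<bullet> p = t * p $ 2 + sqrt (1 - t\<^sup>2) * p $ 3"
  by (simp add: inner_vec_def sum_3)

lemma norm_tilt: "\<bar>t\<bar> \<le> 1 \<Longrightarrow> norm (tilt t) = 1"
  by (simp add: norm_eq_1 inner_tilt flip: power2_eq_square add: abs_square_le_1)

lemma sqrt_one_minus_bounds:
  assumes "\<bar>t\<bar> \<le> 1/4"
  shows "1/2 \<le> sqrt (1 - t\<^sup>2)" "sqrt (1 - t\<^sup>2) \<le> 1"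
proof -
  have "t\<^sup>2 \<le> (1/4)\<^sup>2" using power_mono[OF assms, of 2] by simp
  then show "1/2 \<le> sqrt (1 - t\<^sup>2)"
    by (intro real_le_rsqrt) (simp add: power2_eq_square)
  show "sqrt (1 - t\<^sup>2) \<le> 1" by simp
qed

lemma continuous_on_tilt: "continuous_on S tilt"
proof (subst continuous_on_componentwise, intro ballI)
  fix b :: "real ^ 3" assume "b \<in> Basis"
  then obtain i where b: "b = axis i 1" by (auto simp: Basis_vec_def)
  have "i = 1 \<or> i = 2 \<or> i = 3" by (rule exhaust_3)
  then have "continuous_on S (\<lambda>t. tilt t $ i)"
    by (elim disjE) (auto intro!: continuous_intros)
  then show "continuous_on S (\<lambda>t. tilt t \<bullet> b)"
    by (simp add: b inner_axis)
qed

text \<open>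
  For \<open>t \<noteq> 0\<close> small, the body lies in the direction \<open>tilt t\<close> between two supporting planes at distance 1, and on the
  upper one the \<open>x\<close>-coordinate has the sign of \<open>t\<close> and is at least 1 in absolute value.  This is
  verified for the generators first; for the cylinder piece it rests on
  \<open>2 * (1 - a \<bullet> b) = (norm (a - b))\<^sup>2\<close> for unit vectors \<open>a\<close> and \<open>b\<close> of the plane.
\<close>

lemma kakeya_generators_support:
  assumes t: "\<bar>t\<bar> \<le> 1/4" "t \<noteq> 0" and p: "p \<in> kakeya_generators"
  shows "0 \<le> tilt t \<bullet> p"
    and "tilt t \<bullet> p < 1 \<or> (tilt t \<bullet> p = 1 \<and> 1 \<le> sgn t * p $ 1)"
proof -
  define z where "z = sqrt (1 - t\<^sup>2)"
  have z: "1/2 \<le> z" "z \<le> 1" using sqrt_one_minus_bounds[OF t(1)] by (auto simp: z_def)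
  have "t\<^sup>2 \<le> 1" using t(1) by (simp add: abs_square_le_1)
  then have tz: "t\<^sup>2 + z\<^sup>2 = 1" by (simp add: z_def)
  have val: "tilt t \<bullet> p = t * p $ 2 + z * p $ 3" by (simp add: inner_tilt z_def)
  have tp: "\<bar>t * p $ 2\<bar> \<le> 1/4 * c" if "\<bar>p $ 2\<bar> \<le> c" for c
    unfolding abs_mult using t(1) that by (intro mult_mono) auto
  consider "p $ 2 = 0" "p $ 3 = 0"
    | "1 \<le> \<bar>p $ 1\<bar>" "0 \<le> p $ 1 * p $ 2" "\<bar>p $ 2\<bar> \<le> 1/2" "0 \<le> p $ 3" "(p $ 2)\<^sup>2 + (p $ 3)\<^sup>2 = 1"
    | "\<bar>p $ 2\<bar> \<le> 1" "p $ 3 = 1/2"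
    using p by (auto simp: kakeya_generators_def)
  then have "0 \<le> tilt t \<bullet> p \<and> (tilt t \<bullet> p < 1 \<or> (tilt t \<bullet> p = 1 \<and> 1 \<le> sgn t * p $ 1))"
  proof cases
    case 1
    then show ?thesis by (simp add: val)
  next
    case 2
    have "(p $ 2)\<^sup>2 \<le> (1/2)\<^sup>2" using power_mono[OF 2(3), of 2] by simp
    then have "(1/2)\<^sup>2 \<le> (p $ 3)\<^sup>2" using 2(5) by (simp add: power2_eq_square)
    then have "1/2 \<le> p $ 3" using 2(4) power2_le_imp_le by blast
    then have "1/2 * (1/2) \<le> z * p $ 3" using z by (intro mult_mono) auto
    then have nonneg: "0 \<le> tilt t \<bullet> p" using tp[OF 2(3)] val by linarith
    have eq: "2 * (1 - tilt t \<bullet> p) = (t - p $ 2)\<^sup>2 + (z - p $ 3)\<^sup>2"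
      using tz 2(5) by (simp add: val power2_eq_square algebra_simps)
    show ?thesis
    proof (cases "t = p $ 2")
      case True
      then have "1 \<le> sgn t * p $ 1"
        using 2(1,2) t(2) by (auto simp: sgn_if zero_le_mult_iff)
      moreover have "0 \<le> 2 * (1 - tilt t \<bullet> p)" unfolding eq by simp
      then have "tilt t \<bullet> p \<le> 1" by simp
      ultimately show ?thesis using nonneg by auto
    next
      case False
      then have "0 < 2 * (1 - tilt t \<bullet> p)" unfolding eq by (simp add: add_pos_nonneg)
      then show ?thesis using nonneg by simp
    qed
  next
    case 3
    then have "tilt t \<bullet> p = t * p $ 2 + z / 2" using val by simp
    then have "0 \<le> tilt t \<bullet> p" "tilt t \<bullet> p < 1"
      using tp[OF 3(1)] z by linarith+
    then show ?thesis by simp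
  qed
  then show "0 \<le> tilt t \<bullet> p"
    and "tilt t \<bullet> p < 1 \<or> (tilt t \<bullet> p = 1 \<and> 1 \<le> sgn t * p $ 1)" by auto
qed

lemma kakeya_hull_support:
  assumes t: "\<bar>t\<bar> \<le> 1/4" "t \<noteq> 0" and p: "p \<in> kakeya_hull"
  shows "0 \<le> tilt t \<bullet> p"
    and "tilt t \<bullet> p < 1 \<or> (tilt t \<bullet> p = 1 \<and> 1 \<le> sgn t * p $ 1)"
proof -
  have "kakeya_hull \<subseteq> {w. tilt t \<bullet> w \<ge> 0}"
    unfolding kakeya_hull_def
    using kakeya_generators_support(1)[OF t]
    by (intro hull_minimal convex_halfspace_ge) auto
  then show "0 \<le> tilt t \<bullet> p" using p by auto
  have "convex {w :: real ^ 3. 1 \<le> sgn t * w $ 1}"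
    using convex_halfspace_ge[of 1 "axis 1 (sgn t) :: real ^ 3"]
    by (simp add: inner_axis')
  then have "convex {w. tilt t \<bullet> w < 1 \<or> (tilt t \<bullet> w = 1 \<and> w \<in> {w. 1 \<le> sgn t * w $ 1})}"
    by (rule convex_open_halfspace_Un_face)
  then have "kakeya_hull \<subseteq> {w. tilt t \<bullet> w < 1 \<or> (tilt t \<bullet> w = 1 \<and> w \<in> {w. 1 \<le> sgn t * w $ 1})}"
    unfolding kakeya_hull_def
    using kakeya_generators_support(2)[OF t]
    by (intro hull_minimal) auto
  then show "tilt t \<bullet> p < 1 \<or> (tilt t \<bullet> p = 1 \<and> 1 \<le> sgn t * p $ 1)" using p by auto
qed

text \<open>
  A unit segment in the direction \<open>tilt t\<close> has to join the two supporting planes, and its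
  \<open>x\<close>-coordinate is constant.
\<close>

lemma kakeya_hull_tilted_segment:
  assumes t: "\<bar>t\<bar> \<le> 1/4" "t \<noteq> 0" and w: "w \<in> kakeya_hull" "w + tilt t \<in> kakeya_hull"
  shows "1 \<le> sgn t * w $ 1"
proof -
  have "tilt t \<bullet> (w + tilt t) = tilt t \<bullet> w + 1"
    using norm_tilt[of t] t(1) by (simp add: inner_add_right norm_eq_1)
  then show ?thesis
    using kakeya_hull_support(1)[OF t w(1)] kakeya_hull_support(2)[OF t w(2)] by simp
qed

section \<open>Absence of a continuous choice\<close>

theorem theorem1p5:
  shows "\<exists>K :: (real ^ 3) set. convex_kakeya_body K \<and>
    \<not> (\<exists>\<psi> :: real ^ 3 \<Rightarrow> real ^ 3. continuous_on (sphere 0 1) \<psi> \<and>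
        (\<forall>v \<in> sphere 0 1. \<forall>t \<in> {0..1}. \<psi> v + t *\<^sub>R v \<in> K))"
proof (rule exI[of _ kakeya_hull], intro conjI notI)
  show "convex_kakeya_body kakeya_hull"
  proof (rule convex_kakeya_bodyI_width[OF _ _ kakeya_hull_width])
    show "compact kakeya_hull"
      unfolding kakeya_hull_def by (rule compact_convex_hull[OF compact_kakeya_generators])
    show "convex kakeya_hull"
      unfolding kakeya_hull_def by (rule convex_convex_hull)
  qed
next
  assume "\<exists>\<psi> :: real ^ 3 \<Rightarrow> real ^ 3. continuous_on (sphere 0 1) \<psi> \<and>
        (\<forall>v \<in> sphere 0 1. \<forall>t \<in> {0..1}. \<psi> v + t *\<^sub>R v \<in> kakeya_hull)"
  then obtain \<psi> :: "real ^ 3 \<Rightarrow> real ^ 3" where cont: "continuous_on (sphere 0 1) \<psi>"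
    and seg: "\<And>v t. v \<in> sphere 0 1 \<Longrightarrow> t \<in> {0..1} \<Longrightarrow> \<psi> v + t *\<^sub>R v \<in> kakeya_hull"
    by blast
  define g where "g t = \<psi> (tilt t) $ 1" for t
  have g: "1 \<le> sgn t * g t" if "\<bar>t\<bar> \<le> 1/4" "t \<noteq> 0" for t
    unfolding g_def
    using kakeya_hull_tilted_segment[OF that] seg[of "tilt t" 0] seg[of "tilt t" 1]
      norm_tilt[of t] that by simp
  have "continuous_on {-1..1} (\<lambda>t. \<psi> (tilt t))"
    by (rule continuous_on_compose2[OF cont continuous_on_tilt]) (auto simp: norm_tilt)
  then have cont_g: "continuous_on {-1..1} g"
    unfolding g_def by (intro continuous_intros)
  have "1 \<le> g 0"
  proof (rule continuous_ge_on_closure[where f = g and x = 0 and S = "{0<..<1/4}"])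
    show "continuous_on (closure {0<..<1/4}) g"
      by (rule continuous_on_subset[OF cont_g]) auto
    show "1 \<le> g t" if "t \<in> {0<..<1/4}" for t using g[of t] that by auto
  qed auto
  moreover have "g 0 \<le> -1"
  proof (rule continuous_le_on_closure[where f = g and x = 0 and S = "{-1/4<..<0}"])
    show "continuous_on (closure {-1/4<..<0}) g"
      by (rule continuous_on_subset[OF cont_g]) auto
    show "g t \<le> -1" if "t \<in> {-1/4<..<0}" for t using g[of t] that by auto
  qed auto
  ultimately show False by simp
qed

end
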